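(* Let $m\in\{2,3\}$, let $p^0\in\mathbb R^m$ be the source and let $p_1,p_2,\ldots\in\mathbb R^m$ be sensor positions. Let $\alpha>0$ be known and $0<\sigma^2<\infty$ be unknown, and let $$y_i=\log_{10}\|p_i-p^0\|+\omega_i,\qquad i=1,2,\dots,$$ where $\omega_1,\omega_2,\ldots$ are i.i.d. Gaussian random variables with mean $0$ and variance $\sigma^2/(100\alpha^2)$. Suppose: (a) The source $p^0$ lies within a bounded set $\mathcal P^0$, and the sensors $p_i$, $i=1,\dots,n$, belong to a bounded set $\mathcal P$, independent of $n$; moreover $\mathcal P^0\cap\mathcal P=\emptyset$. (b) The empirical distribution function of $p_1,\dots,p_n$ converges, as $n\to\infty$, to a distribution function $F_\mu$, and $\mu$ denotes the probability measure induced by $F_\mu$. (c) For every $n\ge m+1$, the sensors $p_1,\dots,p_n$ do not lie on a line (when $m=2$) or on a plane (when $m=3$). Moreover, there does not exist any subset $\mathcal P'$ of $\mathcal P$ with $\mu(\mathcal P')=1$ such that $\mathcal P'$ lies entirely on a line (for $m=2$) or on a plane (for $m=3$). (d) For every $n\ge m+2$, the sensors $p_1,\dots,p_n$ do not lie on a circle (when $m=2$) or on a sphere (when $m=3$). Moreover, there does not exist any subset $\mathcal P'$ of $\mathcal P$ with $\mu(\mathcal P')=1$ such that $\mathcal P'$ lies entirely on a circle (for $m=2$) or on a sphere (for $m=3$). Let $\Phi\in\mathbb R^{n\times(m+2)}$ be the matrix with $i$-th row $[-2p_i^T,\ 1,\ \|p_i\|^2]$, let $\Gamma\in\mathbb R^n$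 be the vector with $i$-th entry $10^{2y_i}$, let $\widehat\beta_n=(\Phi^T\Phi)^{-1}\Phi^T\Gamma$, and let $$\widehat p_n=[\widehat\beta_n]_{1:m}\big/[\widehat\beta_n]_{m+2}.$$ Then $$\widehat p_n-p^0=O_p(1/\sqrt n).$$
   Context: $\|\cdot\|$ is the Euclidean norm. $[v]_{1:m}$ is the vector of the first $m$ entries of $v$ and $[v]_{m+2}$ its $(m+2)$-th entry. The empirical distribution of $p_1,\dots,p_n$ is $\frac1n\sum_{i=1}^n\delta_{p_i}$, with $\delta_x$ the Dirac measure at $x$; convergence of distribution functions is in the usual sense (weak convergence). $X_n=O_p(c_n)$ means that $X_n/c_n$ is bounded in probability. Under the stated assumptions $\Phi^T\Phi$ is invertible for $n\ge m+2$. The model arises from received-signal-strength measurements $10\log_{10}(P_i)=10\log_{10}(P_0)-10\alpha\log_{10}\|p_i-p^0\|+\varepsilon_i$ with known constants $P_0>0$ and $\alpha$ and i.i.d. Gaussian noises $\varepsilon_i$ of mean $0$ and variance $\sigma^2$, by setting $y_i=-(\log_{10}P_i-\log_{10}P_0)/\alpha$ and $\omega_i=-\varepsilon_i/(10\alpha)$.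
   Formalization: The formal theorem additionally assumes that μ is carried by the sensor region, μ(P)=1; without this the second halves of (c) and (d) can hold vacuously (e.g. p_i=(u_i,1/(i+1)) in the open unit square) and the claim fails. *)

theory Defs
  imports "HOL-Probability.Probability"
begin

text \<open>
  The order on \<^typ>\<open>real ^ 'm\<close> is the componentwise one, so \<^term>\<open>{..x}\<close> is the lower orthant
  with corner \<^term>\<open>x\<close>. \<^const>\<open>cdf\<close> and \<^const>\<open>weak_conv\<close> are the one-dimensional versions.
\<close>

definition mv_cdf :: "(real ^ 'm) measure \<Rightarrow> real ^ 'm \<Rightarrow> real" where
  "mv_cdf \<mu> x = measure \<mu> {..x}"

text \<open>The summand \<^term>\<open>indicator {..x} (p i)\<close> is the Dirac measure at \<^term>\<open>p i\<close> of \<^term>\<open>{..x}\<close>.\<close>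

definition empirical_cdf :: "(nat \<Rightarrow> real ^ 'm) \<Rightarrow> nat \<Rightarrow> real ^ 'm \<Rightarrow> real" where
  "empirical_cdf p n x = (\<Sum>i=1..n. indicator {..x} (p i)) / real n"

definition mv_weak_conv :: "(nat \<Rightarrow> real ^ 'm \<Rightarrow> real) \<Rightarrow> (real ^ 'm \<Rightarrow> real) \<Rightarrow> bool" where
  "mv_weak_conv F_seq F \<longleftrightarrow> (\<forall>x. isCont F x \<longrightarrow> (\<lambda>n. F_seq n x) \<longlonglongrightarrow> F x)"

definition on_line_or_plane :: "(real ^ 'm) set \<Rightarrow> bool" where
  "on_line_or_plane S \<longleftrightarrow>
     (CARD('m) = 2 \<and> collinear S) \<or> (CARD('m) = 3 \<and> coplanar S)"

definition on_circle_or_sphere :: "(real ^ 'm) set \<Rightarrow> bool" where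
  "on_circle_or_sphere S \<longleftrightarrow> (\<exists>c r. r > 0 \<and> S \<subseteq> sphere c r)"

text \<open>
  Coordinates of \<open>\<real>\<^sup>m\<^sup>+\<^sup>2\<close> are indexed by \<^typ>\<open>'m + 2\<close>: \<^term>\<open>Inl k\<close> are the first \<open>m\<close> of them,
  and \<^term>\<open>Inr (1::2)\<close>, \<^term>\<open>Inr (2::2)\<close> are the entries \<open>m + 1\<close> and \<open>m + 2\<close>.
  An \<open>n \<times> k\<close> matrix with varying \<open>n\<close> is given by its rows \<open>1, \<dots>, n\<close> as a function on \<^typ>\<open>nat\<close>,
  and likewise a vector of length \<open>n\<close> by its entries.
\<close>

definition Phi :: "(nat \<Rightarrow> real ^ 'm) \<Rightarrow> nat \<Rightarrow> real ^ ('m + 2)" where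
  "Phi p i = (\<chi> j. case j of
       Inl k \<Rightarrow> - 2 * p i $ k
     | Inr l \<Rightarrow> if l = 1 then 1 else (norm (p i))\<^sup>2)"

definition Gam :: "(nat \<Rightarrow> real) \<Rightarrow> nat \<Rightarrow> real" where
  "Gam y i = 10 powr (2 * y i)"

text \<open>The products \<open>A\<^sup>T A\<close> and \<open>A\<^sup>T g\<close> for a matrix \<open>A\<close> with \<open>n\<close> rows.\<close>

definition transpose_mult_self :: "nat \<Rightarrow> (nat \<Rightarrow> real ^ 'k) \<Rightarrow> real ^ 'k ^ 'k" where
  "transpose_mult_self n A = (\<chi> j l. \<Sum>i=1..n. A i $ j * A i $ l)"

definition transpose_mult_vec :: "nat \<Rightarrow> (nat \<Rightarrow> real ^ 'k) \<Rightarrow> (nat \<Rightarrow> real) \<Rightarrow> real ^ 'k" where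
  "transpose_mult_vec n A g = (\<chi> j. \<Sum>i=1..n. A i $ j * g i)"

definition beta_hat :: "(nat \<Rightarrow> real ^ 'm) \<Rightarrow> (nat \<Rightarrow> real) \<Rightarrow> nat \<Rightarrow> real ^ ('m + 2)" where
  "beta_hat p y n =
     matrix_inv (transpose_mult_self n (Phi p)) *v transpose_mult_vec n (Phi p) (Gam y)"

definition p_hat :: "(nat \<Rightarrow> real ^ 'm) \<Rightarrow> (nat \<Rightarrow> real) \<Rightarrow> nat \<Rightarrow> real ^ 'm" where
  "p_hat p y n = (\<chi> k. beta_hat p y n $ Inl k / beta_hat p y n $ Inr 2)"

text \<open>
  Measurability is part of the definition because \<^const>\<open>measure\<close> is \<open>0\<close> on non-measurable sets.
\<close>

definition O_prob ::
  "'a measure \<Rightarrow> (nat \<Rightarrow> 'a \<Rightarrow> 'b::real_normed_vector) \<Rightarrow> (nat \<Rightarrow> real) \<Rightarrow> bool" where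
  "O_prob M X c \<longleftrightarrow>
     (\<forall>n. X n \<in> borel_measurable M) \<and>
     (\<forall>\<epsilon>>0. \<exists>K N. \<forall>n\<ge>N. measure M {x \<in> space M. norm (X n x /\<^sub>R c n) > K} < \<epsilon>)"

end

theory Submission
  imports Defs
begin

text \<open>
  Let \<open>\<gamma>\<close> be the mean of the multiplicative noise \<open>10 powr (2 * \<omega> i)\<close>. Then \<open>Gam y i\<close> is the inner
  product of \<open>Phi p i\<close> with \<open>\<beta> = \<gamma> *\<^sub>R (p0, \<parallel>p0\<parallel>\<^sup>2, 1)\<close> plus independent centered noise of bounded
  variance, so the error \<open>d\<close> of the estimator satisfies \<open>\<Phi>\<^sup>T\<Phi> d = T\<close> where \<open>\<parallel>T\<parallel>\<^sup>2\<close> has mean \<open>O(n)\<close>.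
  It remains to bound the least eigenvalue of \<open>\<Phi>\<^sup>T\<Phi>\<close> below by a multiple of \<open>n\<close>. For \<open>v \<noteq> 0\<close>, the zero
  set of \<open>q \<mapsto> \<Phi>(q) \<bullet> v\<close> is empty or contained in a hyperplane or a sphere, hence not of full
  \<open>\<mu>\<close>-measure; thus \<open>\<bar>\<Phi>(q) \<bullet> v\<bar> > \<epsilon>\<close> on an open set of positive measure, which contains a box
  of positive measure whose corners are continuity points, and a positive proportion of the sensors
  falls into that box. Compactness of the unit sphere makes the bound uniform in \<open>v\<close>.
\<close>

section \<open>Empirical frequencies of open sets\<close>

text \<open>The empirical measure on arbitrary sets; on \<open>{..x}\<close> it is
  \<open>empirical_cdf\<close>. The point type is left general so that it also applies to the rows
  \<open>Phi p\<close>.\<close>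

definition empirical_freq :: "(nat \<Rightarrow> 'b) \<Rightarrow> nat \<Rightarrow> 'b set \<Rightarrow> real" where
  "empirical_freq p n A = (\<Sum>i=1..n. indicator A (p i)) / real n"

lemma empirical_freq_mono: "A \<subseteq> B \<Longrightarrow> empirical_freq p n A \<le> empirical_freq p n B"
  unfolding empirical_freq_def
  by (intro divide_right_mono sum_mono) (auto simp: indicator_def)

lemma empirical_freq_Diff:
  assumes "B \<subseteq> A"
  shows "empirical_freq p n (A - B) = empirical_freq p n A - empirical_freq p n B"
proof -
  have "indicator (A - B) x = (indicator A x - indicator B x :: real)" for x
    using assms by (auto simp: indicator_def)
  then show ?thesis
    by (simp only: empirical_freq_def sum_subtractf diff_divide_distrib)
qed

text \<open>If \<open>q\<close> avoids every hyperplane \<open>q $ k = x $ k\<close>, then each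
  comparison of \<open>q\<close> with \<open>u\<close> has the same outcome as with \<open>x\<close>
  once \<open>u\<close> is close to \<open>x\<close>. So the indicators converge almost everywhere,
  and dominated convergence applies.\<close>

lemma isCont_mv_cdf:
  fixes \<mu> :: "(real ^ 'm) measure"
  assumes "prob_space \<mu>" and sets [measurable_cong]: "sets \<mu> = sets borel"
    and null: "\<And>k. measure \<mu> {q. q $ k = x $ k} = 0"
  shows "isCont (mv_cdf \<mu>) x"
proof -
  interpret prob_space \<mu> by fact
  have [measurable]: "{..u} \<in> sets \<mu>" for u :: "real ^ 'm"
    by (simp add: sets)
  have [measurable]: "{q. q $ k = x $ k} \<in> sets \<mu>" for k
  proof -
    have "closed {q :: real ^ 'm. q $ k = x $ k}"
      by (intro closed_Collect_eq continuous_intros)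
    then show ?thesis by (simp add: sets)
  qed
  have ae: "AE q in \<mu>. \<forall>k. q $ k \<noteq> x $ k"
  proof (subst AE_all_countable, intro allI)
    fix k
    show "AE q in \<mu>. q $ k \<noteq> x $ k"
      by (rule AE_I[where N = "{q. q $ k = x $ k}"]) (auto simp: null emeasure_eq_measure)
  qed
  show ?thesis
    unfolding continuous_at_sequentially comp_def
  proof (intro allI impI)
    fix u assume u: "u \<longlonglongrightarrow> x"
    have "(\<lambda>n. \<integral>q. indicator {..u n} q \<partial>\<mu>) \<longlonglongrightarrow> (\<integral>q. indicator {..x} q \<partial>\<mu> :: real)"
    proof (rule integral_dominated_convergence[where w = "\<lambda>_. 1"])
      show "AE q in \<mu>. (\<lambda>n. indicator {..u n} q) \<longlonglongrightarrow> (indicator {..x} q :: real)"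
        using ae
      proof eventually_elim
        case (elim q)
        have "\<forall>\<^sub>F n in sequentially. q $ k \<le> u n $ k \<longleftrightarrow> q $ k \<le> x $ k" for k
        proof -
          have lim: "(\<lambda>n. u n $ k) \<longlonglongrightarrow> x $ k"
            using u by (rule tendsto_vec_nth)
          consider "q $ k < x $ k" | "q $ k > x $ k" using elim by (meson linorder_neqE)
          then show ?thesis
          proof cases
            case 1
            from order_tendstoD(1)[OF lim this] show ?thesis
              by eventually_elim (use 1 in auto)
          next
            case 2
            from order_tendstoD(2)[OF lim this] show ?thesis
              by eventually_elim (use 2 in auto)
          qed
        qed
        then have "\<forall>\<^sub>F n in sequentially. \<forall>k. q $ k \<le> u n $ k \<longleftrightarrow> q $ k \<le> x $ k"
          by (simp add: eventually_all_finite)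
        then have "\<forall>\<^sub>F n in sequentially. indicator {..u n} q = (indicator {..x} q :: real)"
          by eventually_elim (auto simp: indicator_def less_eq_vec_def)
        then show ?case by (rule tendsto_eventually)
      qed
    qed auto
    then show "(\<lambda>n. mv_cdf \<mu> (u n)) \<longlonglongrightarrow> mv_cdf \<mu> x"
      by (simp add: mv_cdf_def sets_eq_imp_space_eq[OF sets])
  qed
qed

lemma empirical_freq_box_tendsto:
  fixes \<mu> :: "(real ^ 'm) measure" and a b :: "real ^ 'm"
  assumes "prob_space \<mu>" and sets: "sets \<mu> = sets borel"
    and conv: "mv_weak_conv (empirical_cdf p) (mv_cdf \<mu>)"
    and a: "\<And>k. measure \<mu> {q. q $ k = a $ k} = 0"
    and b: "\<And>k. measure \<mu> {q. q $ k = b $ k} = 0"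
    and le: "a \<le> b"
  shows "(\<lambda>n. empirical_freq p n {q. q \<le> b \<and> (\<forall>k. a $ k < q $ k)})
    \<longlonglongrightarrow> measure \<mu> {q. q \<le> b \<and> (\<forall>k. a $ k < q $ k)}"
proof -
  interpret prob_space \<mu> by fact
  \<comment> \<open>Bounded below only in the coordinates \<open>S\<close>: adding a coordinate to \<open>S\<close> subtracts a set of the
    same shape, so induction on \<open>S\<close> leads from orthants to boxes.\<close>
  define B where "B S c = {q. q \<le> c \<and> (\<forall>k\<in>S. a $ k < q $ k)}" for S and c :: "real ^ 'm"
  have meas: "B S c \<in> sets \<mu>" for S c
  proof -
    have "B S c = {..c} \<inter> (\<Inter>k\<in>S. {q. a $ k < q $ k})"
      by (auto simp: B_def)
    moreover have "open (\<Inter>k\<in>S. {q :: real ^ 'm. a $ k < q $ k})"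
      by (intro open_INT ballI finite open_Collect_less continuous_intros)
    ultimately show ?thesis by (simp add: sets)
  qed
  have "(\<lambda>n. empirical_freq p n (B S c)) \<longlonglongrightarrow> measure \<mu> (B S c)"
    if "finite S" "a \<le> c" "\<And>k. measure \<mu> {q. q $ k = c $ k} = 0" for S c
    using that
  proof (induction S arbitrary: c)
    case empty
    then have "isCont (mv_cdf \<mu>) c"
      using isCont_mv_cdf[OF assms(1) sets] by blast
    then show ?case
      using conv by (simp add: mv_weak_conv_def empirical_cdf_def mv_cdf_def B_def
        empirical_freq_def atMost_def)
  next
    case (insert k S)
    \<comment> \<open>Lowering coordinate \<open>k\<close> of the corner to \<open>a $ k\<close>
      describes exactly the points of \<open>B S c\<close> that violate the new constraint. The
      hyperplanes through \<open>c'\<close> are still null, since each coordinate comes from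
      \<open>a\<close> or \<open>c\<close>.\<close>
    define c' where "c' = (\<chi> j. if j = k then a $ k else c $ j)"
    have eq: "B (insert k S) c = B S c - B S c'" and sub: "B S c' \<subseteq> B S c"
      using insert.prems(1) by (auto simp: B_def c'_def less_eq_vec_def not_le split: if_splits
        intro: order_trans)
    have "a \<le> c'" "\<And>j. measure \<mu> {q. q $ j = c' $ j} = 0"
      using insert.prems a by (auto simp: c'_def less_eq_vec_def)
    then have "(\<lambda>n. empirical_freq p n (B S c) - empirical_freq p n (B S c'))
        \<longlonglongrightarrow> measure \<mu> (B S c) - measure \<mu> (B S c')"
      using insert by (intro tendsto_diff insert.IH) auto
    then show ?case
      by (simp add: eq empirical_freq_Diff[OF sub] finite_measure_Diff[OF meas meas sub])
  qed
  from this[of UNIV b] show ?thesis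
    using le b by (simp add: B_def)
qed

text \<open>These hyperplanes are the atoms of the pushforward of \<mu> under the
  \<open>k\<close>-th coordinate, and a probability measure on the line has only countably
  many.\<close>

lemma countable_atoms_coordinate:
  fixes \<mu> :: "(real ^ 'm) measure"
  assumes "prob_space \<mu>" and sets [measurable_cong]: "sets \<mu> = sets borel"
  shows "countable {t. measure \<mu> {q. q $ k = t} \<noteq> 0}"
proof -
  interpret prob_space \<mu> by fact
  have [measurable]: "(\<lambda>q. q $ k) \<in> borel_measurable \<mu>"
    by measurable
  interpret D: prob_space "distr \<mu> borel (\<lambda>q. q $ k)"
    by (rule prob_space_distr) simp
  have "measure (distr \<mu> borel (\<lambda>q. q $ k)) {t} = measure \<mu> {q. q $ k = t}" for t
    by (subst measure_distr) (auto simp: sets_eq_imp_space_eq[OF sets] vimage_def)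
  then show ?thesis
    using D.countable_support by simp
qed

text \<open>Every point of \<open>U\<close> lies inside a box within \<open>U\<close> whose corner
  coordinates avoid the atoms. Countably many such boxes cover \<open>U\<close>, so they cannot all
  be null.\<close>

lemma exists_box_positive_measure:
  fixes \<mu> :: "(real ^ 'm) measure"
  assumes "prob_space \<mu>" and sets: "sets \<mu> = sets borel"
    and U: "open U" "measure \<mu> U > 0"
  shows "\<exists>a b. a \<le> b \<and> {q. q \<le> b \<and> (\<forall>k. a $ k < q $ k)} \<subseteq> U \<and>
    (\<forall>k. measure \<mu> {q. q $ k = a $ k} = 0) \<and> (\<forall>k. measure \<mu> {q. q $ k = b $ k} = 0) \<and>
    measure \<mu> {q. q \<le> b \<and> (\<forall>k. a $ k < q $ k)} > 0"
proof -
  interpret prob_space \<mu> by fact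
  define good where "good a b \<longleftrightarrow> a \<le> b \<and> {q. q \<le> b \<and> (\<forall>k. a $ k < q $ k)} \<subseteq> U \<and>
    (\<forall>k. measure \<mu> {q. q $ k = a $ k} = 0) \<and> (\<forall>k. measure \<mu> {q. q $ k = b $ k} = 0)"
    for a b :: "real ^ 'm"
  have non_atom: "\<exists>t. l < t \<and> t < u \<and> measure \<mu> {q. q $ k = t} = 0" if "l < u" for l u k
  proof (rule ccontr)
    assume "\<not> ?thesis"
    then have "{l<..<u} \<subseteq> {t. measure \<mu> {q. q $ k = t} \<noteq> 0}" by auto
    then have "countable {l<..<u}"
      using countable_atoms_coordinate[OF assms(1) sets] countable_subset by blast
    then show False using that using uncountable_open_interval by blast
  qed
  have cover: "\<exists>a b. good a b \<and> x \<in> box a b" if "x \<in> U" for x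
  proof -
    obtain l u where lu: "cbox l u \<subseteq> U" "x \<in> box l u"
      using open_contains_cbox[OF U(1) \<open>x \<in> U\<close>] by metis
    have "\<exists>t. l $ k < t \<and> t < x $ k \<and> measure \<mu> {q. q $ k = t} = 0" for k
      using lu(2) by (intro non_atom) (simp add: mem_box_cart)
    then obtain f where f: "\<And>k. l $ k < f k \<and> f k < x $ k \<and> measure \<mu> {q. q $ k = f k} = 0"
      by metis
    have "\<exists>t. x $ k < t \<and> t < u $ k \<and> measure \<mu> {q. q $ k = t} = 0" for k
      using lu(2) by (intro non_atom) (simp add: mem_box_cart)
    then obtain g where g: "\<And>k. x $ k < g k \<and> g k < u $ k \<and> measure \<mu> {q. q $ k = g k} = 0"
      by metis
    have "{q. q \<le> vec_lambda g \<and> (\<forall>k. vec_lambda f $ k < q $ k)} \<subseteq> cbox l u"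
      using f g by (auto simp: mem_box_cart less_eq_vec_def) (meson less_imp_le order_trans)+
    then have "good (vec_lambda f) (vec_lambda g)"
      using f g lu(1) by (auto simp: good_def less_eq_vec_def) (meson less_imp_le order_trans)
    moreover have "x \<in> box (vec_lambda f) (vec_lambda g)"
      using f g by (simp add: mem_box_cart)
    ultimately show ?thesis by blast
  qed
  have "\<exists>a b. good a b \<and> measure \<mu> {q. q \<le> b \<and> (\<forall>k. a $ k < q $ k)} > 0"
  proof (rule ccontr)
    assume none: "\<not> ?thesis"
    \<comment> \<open>The Lindelof property needs open sets, hence open boxes here; each lies in its
      half-open counterpart, which is null by assumption.\<close>
    define F where "F = {box a b | a b. good a b}"
    obtain F' where F': "F' \<subseteq> F" "countable F'" "\<Union>F' = \<Union>F"
      using Lindelof[of F] by (auto simp: F_def)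
    have "X \<in> null_sets \<mu>" if "X \<in> F" for X
    proof -
      obtain a b where ab: "X = box a b" "good a b" using \<open>X \<in> F\<close> by (auto simp: F_def)
      let ?B = "{q. q \<le> b \<and> (\<forall>k. a $ k < q $ k)}"
      have "?B = {..b} \<inter> (\<Inter>k. {q. a $ k < q $ k})" by auto
      moreover have "open (\<Inter>k. {q :: real ^ 'm. a $ k < q $ k})"
        by (intro open_INT ballI finite open_Collect_less continuous_intros)
      ultimately have meas: "?B \<in> sets \<mu>" by (simp add: sets)
      have "measure \<mu> ?B = 0"
        using none ab(2) measure_nonneg[of \<mu> ?B] by (metis (no_types, lifting) order_le_less)
      moreover have "X \<subseteq> ?B"
        unfolding ab by (auto simp: mem_box_cart less_eq_vec_def intro: less_imp_le)
      then have "measure \<mu> X \<le> measure \<mu> ?B"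
        by (rule finite_measure_mono) (rule meas)
      ultimately have "measure \<mu> X = 0" using measure_nonneg[of \<mu> X] by linarith
      then show ?thesis by (simp add: ab null_sets_def sets emeasure_eq_measure)
    qed
    then have "\<Union>F' \<in> null_sets \<mu>"
      using null_sets_UN'[OF F'(2), of "\<lambda>X. X"] F'(1) by auto
    moreover have "U \<subseteq> \<Union>F'"
      unfolding F'(3) F_def using cover by blast
    ultimately have "measure \<mu> U \<le> 0"
      using finite_measure_mono[of U "\<Union>F'"] by (auto simp: null_sets_def measure_def)
    then show False using U(2) by simp
  qed
  then show ?thesis
    by (simp add: good_def conj_assoc)
qed

text \<open>A weak form of the portmanteau inequality for open sets: the frequency of a box inside
  \<open>U\<close> converges to its positive measure, so it eventually exceeds half of that
  value.\<close>

lemma empirical_freq_open_bounded_below: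
  fixes \<mu> :: "(real ^ 'm) measure"
  assumes "prob_space \<mu>" "sets \<mu> = sets borel"
    and "mv_weak_conv (empirical_cdf p) (mv_cdf \<mu>)"
    and "open U" "measure \<mu> U > 0"
  obtains \<delta> where "\<delta> > 0" "\<forall>\<^sub>F n in sequentially. \<delta> \<le> empirical_freq p n U"
proof -
  obtain a b where ab: "a \<le> b" "{q. q \<le> b \<and> (\<forall>k. a $ k < q $ k)} \<subseteq> U" (is "?B \<subseteq> U")
    "measure \<mu> {q. q \<le> b \<and> (\<forall>k. a $ k < q $ k)} > 0"
    "\<And>k. measure \<mu> {q. q $ k = a $ k} = 0" "\<And>k. measure \<mu> {q. q $ k = b $ k} = 0"
    using exists_box_positive_measure[OF assms(1,2,4,5)] by blast
  have "(\<lambda>n. empirical_freq p n ?B) \<longlonglongrightarrow> measure \<mu> ?B"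
    using assms ab by (intro empirical_freq_box_tendsto) auto
  then have "\<forall>\<^sub>F n in sequentially. measure \<mu> ?B / 2 < empirical_freq p n ?B"
    by (rule order_tendstoD(1)) (use ab in simp)
  then have "\<forall>\<^sub>F n in sequentially. measure \<mu> ?B / 2 \<le> empirical_freq p n U"
    by eventually_elim (use empirical_freq_mono[OF ab(2)] in \<open>meson less_imp_le order_trans\<close>)
  then show thesis using that[of "measure \<mu> ?B / 2"] ab(3) by simp
qed

section \<open>The quadratic form of the design matrix\<close>

lemma UNIV_sum_Plus:
  "sum f (UNIV :: ('a::finite + 'b::finite) set) = (\<Sum>k\<in>UNIV. f (Inl k)) + (\<Sum>l\<in>UNIV. f (Inr l))"
  using sum.Plus[of "UNIV :: 'a set" "UNIV :: 'b set" f] by (simp add: comp_def)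

text \<open>A linear form in the row is a quadratic polynomial in the position with scalar leading
  part, so its zero sets are of the kind treated in \<open>quadric_cases\<close>.\<close>

lemma Phi_inner:
  "Phi p i \<bullet> v = - 2 * ((\<chi> k. v $ Inl k) \<bullet> p i) + v $ Inr 1 + v $ Inr 2 * (norm (p i))\<^sup>2"
  by (simp add: inner_vec_def UNIV_sum_Plus Phi_def sum_2 sum_distrib_left mult_ac sum_negf)

lemma bounded_Phi:
  fixes p :: "nat \<Rightarrow> real ^ 'm"
  assumes "bounded P" "\<And>i. i \<ge> 1 \<Longrightarrow> p i \<in> P"
  obtains B where "B > 0" "\<And>i. i \<ge> 1 \<Longrightarrow> norm (Phi p i) \<le> B"
proof -
  obtain R where R: "R > 0" "\<And>q. q \<in> P \<Longrightarrow> norm q \<le> R"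
    using assms(1) by (meson bounded_pos)
  define B where "B = 2 * real CARD('m) * R + 1 + R\<^sup>2"
  have "norm (Phi p i) \<le> B" if "i \<ge> 1" for i
  proof -
    have r: "norm (p i) \<le> R" using R(2) assms(2) that by blast
    have "norm (Phi p i) \<le> (\<Sum>j\<in>UNIV. \<bar>Phi p i $ j\<bar>)"
      by (rule norm_le_l1_cart)
    also have "\<dots> = (\<Sum>k\<in>UNIV. 2 * \<bar>p i $ k\<bar>) + 1 + (norm (p i))\<^sup>2"
      by (simp add: UNIV_sum_Plus Phi_def sum_2 abs_mult)
    also have "\<dots> \<le> (\<Sum>k\<in>(UNIV :: 'm set). 2 * R) + 1 + R\<^sup>2"
      using component_le_norm_cart[of "p i"] r
      by (intro add_mono sum_mono mult_left_mono power_mono) (auto intro: order_trans)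
    finally show ?thesis by (simp add: B_def)
  qed
  moreover have "B > 0" using R(1) by (simp add: B_def add_nonneg_pos add_pos_nonneg)
  ultimately show thesis using that by blast
qed

lemma on_line_or_plane_subset:
  "on_line_or_plane T \<Longrightarrow> S \<subseteq> T \<Longrightarrow> on_line_or_plane S"
  unfolding on_line_or_plane_def coplanar_def using collinear_subset by blast

text \<open>An affine basis has at most three points, which are coplanar, and coplanarity passes to
  the affine hull.\<close>

lemma coplanar_if_aff_dim_le:
  fixes S :: "'a::euclidean_space set"
  assumes "aff_dim S \<le> 2"
  shows "coplanar S"
proof -
  obtain B where B: "\<not> affine_dependent B" "B \<subseteq> S" "affine hull B = affine hull S"
    by (metis affine_basis_exists)
  have "finite B" using B(1) by (rule aff_independent_finite)
  moreover have "card B \<le> 3"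
    using aff_dim_unique[of B S] B assms by auto
  ultimately have "coplanar B" by (rule coplanar_small)
  then show ?thesis
    using B(3) by (metis coplanar_affine_hull_coplanar)
qed

lemma on_line_or_plane_hyperplane:
  fixes a :: "real ^ 'm"
  assumes "CARD('m) \<in> {2, 3}" "a \<noteq> 0"
  shows "on_line_or_plane {q. a \<bullet> q = b}"
  using assms by (auto simp: on_line_or_plane_def collinear_aff_dim coplanar_if_aff_dim_le)

text \<open>Covers the sphere of radius zero, which \<open>on_circle_or_sphere\<close>
  excludes.\<close>

lemma on_line_or_plane_singleton:
  "CARD('m) \<in> {2, 3} \<Longrightarrow> on_line_or_plane {q :: real ^ 'm}"
  by (auto simp: on_line_or_plane_def coplanar_sing)

lemma quadric_cases:
  fixes a :: "real ^ 'm"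
  assumes dim: "CARD('m) \<in> {2, 3}"
    and nontrivial: "a \<noteq> 0 \<or> b \<noteq> 0 \<or> d \<noteq> 0"
  defines "Z \<equiv> {q. - 2 * (a \<bullet> q) + b + d * (norm q)\<^sup>2 = 0}"
  shows "Z = {} \<or> on_line_or_plane Z \<or> on_circle_or_sphere Z"
proof (cases "d = 0")
  case True
  show ?thesis
  proof (cases "a = 0")
    case False
    have "Z = {q. a \<bullet> q = b / 2}" by (auto simp: Z_def True)
    then show ?thesis using on_line_or_plane_hyperplane[OF dim False] by metis
  qed (use True nontrivial in \<open>auto simp: Z_def\<close>)
next
  case False
  \<comment> \<open>Completing the square gives centre \<open>a /\<^sub>R d\<close> and squared
    radius \<rho>; a negative \<rho> forces \<open>Z\<close> to be empty.\<close>
  define \<rho> where "\<rho> = (norm (a /\<^sub>R d))\<^sup>2 - b / d"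
  have Z: "(dist (a /\<^sub>R d) q)\<^sup>2 = \<rho>" if "q \<in> Z" for q
  proof -
    have "d * ((dist (a /\<^sub>R d) q)\<^sup>2 - \<rho>) = - 2 * (a \<bullet> q) + b + d * (norm q)\<^sup>2"
      using False
      by (simp add: \<rho>_def dist_norm power2_norm_eq_inner inner_diff inner_commute field_simps)
        (simp add: power2_eq_square)
    then show ?thesis using that False by (simp add: Z_def)
  qed
  consider "Z = {}" | "\<rho> = 0" | "\<rho> > 0"
    using Z by (metis all_not_in_conv less_eq_real_def zero_le_power2)
  then show ?thesis
  proof cases
    case 2
    then have "Z \<subseteq> {a /\<^sub>R d}" using Z by auto
    then show ?thesis
      using on_line_or_plane_singleton[OF dim] on_line_or_plane_subset by blast
  next
    case 3
    then have "Z \<subseteq> sphere (a /\<^sub>R d) (sqrt \<rho>)"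
      using Z by (auto simp flip: real_sqrt_unique)
    then show ?thesis
      using 3 unfolding on_circle_or_sphere_def by (metis real_sqrt_gt_0_iff)
  qed simp
qed

text \<open>Boundedness of the vectors extends the estimate at one \<open>v\<close> to a ball around
  it, finitely many balls cover the unit sphere, and homogeneity reaches all other vectors.\<close>

lemma uniform_quadratic_form_bound:
  fixes \<phi> :: "nat \<Rightarrow> 'b::euclidean_space"
  assumes bound: "\<And>i. i \<ge> 1 \<Longrightarrow> norm (\<phi> i) \<le> B"
    and pos: "\<And>v. v \<noteq> 0 \<Longrightarrow> \<exists>\<epsilon>>0. \<exists>\<delta>>0. \<forall>\<^sub>F n in sequentially.
      \<delta> \<le> empirical_freq \<phi> n {w. \<bar>w \<bullet> v\<bar> > \<epsilon>}"
  obtains c where "c > 0"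
    "\<forall>\<^sub>F n in sequentially. \<forall>v. c * real n * (norm v)\<^sup>2 \<le> (\<Sum>i=1..n. (\<phi> i \<bullet> v)\<^sup>2)"
proof -
  \<comment> \<open>A strictly positive bound, so that the radius
    \<open>\<epsilon> / (2 * B')\<close> below is meaningful.\<close>
  define B' where "B' = max B 1"
  have B': "B' > 0" "\<And>i. i \<ge> 1 \<Longrightarrow> norm (\<phi> i) \<le> B'"
    using bound by (auto simp: B'_def intro: max.coboundedI1)
  \<comment> \<open>The threshold on \<open>n\<close> precedes the quantifier over \<open>u\<close>,
    so it is common to the whole neighbourhood.\<close>
  define nbhd where "nbhd v T c \<longleftrightarrow> open T \<and> v \<in> T \<and> c > 0 \<and>
      (\<forall>\<^sub>F n in sequentially. \<forall>u\<in>T. c * real n \<le> (\<Sum>i=1..n. (\<phi> i \<bullet> u)\<^sup>2))" for v T c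
  have "\<forall>v\<in>sphere 0 1. \<exists>T c. nbhd v T c"
  proof
    fix v :: 'b assume "v \<in> sphere 0 1"
    then have "v \<noteq> 0" by auto
    then obtain \<epsilon> \<delta> where ed: "\<epsilon> > 0" "\<delta> > 0"
      "\<forall>\<^sub>F n in sequentially. \<delta> \<le> empirical_freq \<phi> n {w. \<bar>w \<bullet> v\<bar> > \<epsilon>}"
      using pos by blast
    \<comment> \<open>With this radius, replacing \<open>v\<close> by \<open>u\<close> changes each
      inner product by at most \<open>\<epsilon> / 2\<close>, so values above \<epsilon> stay at
      least \<open>\<epsilon> / 2\<close>.\<close>
    define T where "T = ball v (\<epsilon> / (2 * B'))"
    have "\<forall>\<^sub>F n in sequentially. \<forall>u\<in>T. (\<epsilon> / 2)\<^sup>2 * \<delta> * real n \<le> (\<Sum>i=1..n. (\<phi> i \<bullet> u)\<^sup>2)"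
      using ed(3) eventually_gt_at_top[of 0]
    proof eventually_elim
      case (elim n)
      show ?case
      proof
        fix u assume u: "u \<in> T"
        have "(\<epsilon> / 2)\<^sup>2 * \<delta> * real n \<le> (\<epsilon> / 2)\<^sup>2 * (\<Sum>i=1..n. indicator {w. \<bar>w \<bullet> v\<bar> > \<epsilon>} (\<phi> i))"
          using elim by (simp add: empirical_freq_def pos_le_divide_eq mult.assoc mult_left_mono)
        also have "\<dots> \<le> (\<Sum>i=1..n. (\<phi> i \<bullet> u)\<^sup>2)"
          unfolding sum_distrib_left
        proof (rule sum_mono)
          fix i assume i: "i \<in> {1..n}"
          have "\<bar>\<phi> i \<bullet> (v - u)\<bar> \<le> norm (\<phi> i) * norm (v - u)"
            by (rule Cauchy_Schwarz_ineq2)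
          also have "\<dots> \<le> B' * (\<epsilon> / (2 * B'))"
            using B' u i by (intro mult_mono) (auto simp: T_def dist_norm)
          also have "\<dots> = \<epsilon> / 2" using B'(1) by simp
          finally have "\<bar>\<phi> i \<bullet> v\<bar> > \<epsilon> \<Longrightarrow> \<epsilon> / 2 \<le> \<bar>\<phi> i \<bullet> u\<bar>"
            unfolding inner_diff_right by linarith
          then have "\<bar>\<phi> i \<bullet> v\<bar> > \<epsilon> \<Longrightarrow> (\<epsilon> / 2)\<^sup>2 \<le> (\<phi> i \<bullet> u)\<^sup>2"
            using ed(1) by (metis abs_le_square_iff abs_of_pos half_gt_zero)
          then show "(\<epsilon> / 2)\<^sup>2 * indicator {w. \<bar>w \<bullet> v\<bar> > \<epsilon>} (\<phi> i) \<le> (\<phi> i \<bullet> u)\<^sup>2"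
            by (auto simp: indicator_def)
        qed
        finally show "(\<epsilon> / 2)\<^sup>2 * \<delta> * real n \<le> (\<Sum>i=1..n. (\<phi> i \<bullet> u)\<^sup>2)" .
      qed
    qed
    moreover have "open T" "v \<in> T" "(\<epsilon> / 2)\<^sup>2 * \<delta> > 0"
      using ed B'(1) by (auto simp: T_def)
    ultimately show "\<exists>T c. nbhd v T c"
      unfolding nbhd_def by blast
  qed
  then obtain T c where "\<And>v. v \<in> sphere 0 1 \<Longrightarrow> nbhd v (T v) (c v)"
    by metis
  note Tc = this[unfolded nbhd_def]
  obtain D where D: "D \<subseteq> sphere 0 1" "finite D" "sphere 0 1 \<subseteq> (\<Union>v\<in>D. T v)"
  proof (rule compactE_image[of "sphere (0::'b) 1" "sphere 0 1" T])
    show "sphere 0 1 \<subseteq> (\<Union>v\<in>sphere 0 1. T v)" using Tc by blast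
  qed (use Tc in auto)
  define m where "m = Min (insert 1 (c ` D))"
  have m: "m > 0" "\<And>v. v \<in> D \<Longrightarrow> m \<le> c v"
    using D(1,2) Tc by (auto simp: m_def)
  have "\<forall>\<^sub>F n in sequentially. \<forall>v\<in>D. \<forall>u\<in>T v. c v * real n \<le> (\<Sum>i=1..n. (\<phi> i \<bullet> u)\<^sup>2)"
    using D Tc by (subst eventually_ball_finite_distrib) auto
  then have "\<forall>\<^sub>F n in sequentially. \<forall>v. m * real n * (norm v)\<^sup>2 \<le> (\<Sum>i=1..n. (\<phi> i \<bullet> v)\<^sup>2)"
  proof eventually_elim
    case (elim n)
    show ?case
    proof
      fix v :: 'b
      show "m * real n * (norm v)\<^sup>2 \<le> (\<Sum>i=1..n. (\<phi> i \<bullet> v)\<^sup>2)"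
      proof (cases "v = 0")
        case False
        then have "sgn v \<in> sphere 0 1" by (simp add: norm_sgn)
        then obtain u where u: "u \<in> D" "sgn v \<in> T u" using D(3) by blast
        have "m * real n \<le> c u * real n"
          using m(2)[OF u(1)] by (simp add: mult_right_mono)
        also have "\<dots> \<le> (\<Sum>i=1..n. (\<phi> i \<bullet> sgn v)\<^sup>2)"
          using elim u by blast
        finally have "m * real n * (norm v)\<^sup>2 \<le> (\<Sum>i=1..n. (\<phi> i \<bullet> sgn v)\<^sup>2) * (norm v)\<^sup>2"
          by (simp add: mult_right_mono)
        also have "\<dots> = (\<Sum>i=1..n. (\<phi> i \<bullet> v)\<^sup>2)"
          unfolding sum_distrib_right
          by (intro sum.cong refl) (use False in \<open>simp add: sgn_div_norm field_simps\<close>)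
        finally show ?thesis .
      qed simp
    qed
  qed
  then show thesis using that m(1) by blast
qed

lemma Phi_quadratic_form_lower_bound:
  fixes p :: "nat \<Rightarrow> real ^ 'm" and \<mu> :: "(real ^ 'm) measure"
  assumes dim: "CARD('m) \<in> {2, 3}"
    and P: "bounded P" "\<And>i. i \<ge> 1 \<Longrightarrow> p i \<in> P"
    and \<mu>: "prob_space \<mu>" "sets \<mu> = sets borel" "AE q in \<mu>. q \<in> P"
    and conv: "mv_weak_conv (empirical_cdf p) (mv_cdf \<mu>)"
    and no_plane: "\<not> (\<exists>P'. P' \<subseteq> P \<and> measure \<mu> P' = 1 \<and> on_line_or_plane P')"
    and no_sphere: "\<not> (\<exists>P'. P' \<subseteq> P \<and> measure \<mu> P' = 1 \<and> on_circle_or_sphere P')"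
  obtains c where "c > 0"
    "\<forall>\<^sub>F n in sequentially. \<forall>v. c * real n * (norm v)\<^sup>2 \<le> (\<Sum>i=1..n. (Phi p i \<bullet> v)\<^sup>2)"
proof -
  interpret prob_space \<mu> by fact
  have space: "space \<mu> = UNIV"
    using sets_eq_imp_space_eq[OF \<mu>(2)] by simp
  obtain B where B: "\<And>i. i \<ge> 1 \<Longrightarrow> norm (Phi p i) \<le> B"
    using bounded_Phi[of P p] P by blast
  have pos: "\<exists>\<epsilon>>0. \<exists>\<delta>>0. \<forall>\<^sub>F n in sequentially.
      \<delta> \<le> empirical_freq (Phi p) n {w. \<bar>w \<bullet> v\<bar> > \<epsilon>}" if "v \<noteq> 0" for v
  proof -
    define a where "a = (\<chi> k. v $ Inl k)"
    define f where "f q = - 2 * (a \<bullet> q) + v $ Inr 1 + v $ Inr 2 * (norm q)\<^sup>2" for q :: "real ^ 'm"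
    define Z where "Z = {q. f q = 0}"
    have cont: "continuous_on UNIV f"
      unfolding f_def by (intro continuous_intros)
    have open_U: "open {q. \<bar>f q\<bar> > e}" for e
      by (intro open_Collect_less continuous_intros cont)
    have Z_sets: "Z \<in> sets \<mu>"
      unfolding Z_def \<mu>(2) by (intro borel_closed closed_Collect_eq cont continuous_intros)
    have "a \<noteq> 0 \<or> v $ Inr 1 \<noteq> 0 \<or> v $ Inr 2 \<noteq> 0"
    proof (rule ccontr)
      assume "\<not> ?thesis"
      then have "v $ j = 0" for j
        by (cases j) (auto simp: a_def vec_eq_iff, metis exhaust_2)
      then show False using \<open>v \<noteq> 0\<close> by (simp add: vec_eq_iff)
    qed
    then have Z_cases: "Z = {} \<or> on_line_or_plane Z \<or> on_circle_or_sphere Z"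
      unfolding Z_def f_def by (rule quadric_cases[OF dim])
    \<comment> \<open>The limit conditions speak only of subsets of \<open>P\<close>. Deleting a
      null set outside of which all points belong to \<open>P\<close> turns \<open>Z\<close> into
      such a subset without changing its measure.\<close>
    have "measure \<mu> Z \<noteq> 1"
    proof
      assume Z1: "measure \<mu> Z = 1"
      obtain N where N: "\<And>q. q \<notin> N \<Longrightarrow> q \<in> P" "N \<in> null_sets \<mu>"
        using AE_E3[OF \<mu>(3)] by (metis DiffI UNIV_I space)
      have "measure \<mu> (Z - N) = 1"
        using measure_Diff_null_set[OF Z_sets N(2)] Z1 by simp
      moreover have "Z - N \<subseteq> P" using N(1) by auto
      ultimately have "\<not> on_line_or_plane (Z - N)" "\<not> on_circle_or_sphere (Z - N)"
        using no_plane no_sphere by blast+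
      then have "\<not> on_line_or_plane Z" "\<not> on_circle_or_sphere Z"
        using on_line_or_plane_subset unfolding on_circle_or_sphere_def by blast+
      then show False using Z_cases Z1 by auto
    qed
    then have "measure \<mu> (- Z) > 0"
      using prob_compl[OF Z_sets] by (simp add: space Compl_eq_Diff_UNIV order_less_le)
    \<comment> \<open>These sets exhaust the complement of \<open>Z\<close>; if all were null, so
      would be their countable union.\<close>
    have "\<exists>k. measure \<mu> {q. \<bar>f q\<bar> > inverse (real (Suc k))} > 0"
    proof (rule ccontr)
      assume none: "\<not> ?thesis"
      have "{q. \<bar>f q\<bar> > inverse (real (Suc k))} \<in> null_sets \<mu>" for k
        using none measure_nonneg[of \<mu> "{q. \<bar>f q\<bar> > inverse (real (Suc k))}"] open_U
        by (auto simp: null_sets_def \<mu>(2) emeasure_eq_measure not_less intro: antisym)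
      then have "(\<Union>k. {q. \<bar>f q\<bar> > inverse (real (Suc k))}) \<in> null_sets \<mu>"
        by (rule null_sets_UN)
      moreover have "- Z \<subseteq> (\<Union>k. {q. \<bar>f q\<bar> > inverse (real (Suc k))})"
      proof
        fix q assume "q \<in> - Z"
        then have "\<bar>f q\<bar> > 0" by (simp add: Z_def)
        then show "q \<in> (\<Union>k. {q. \<bar>f q\<bar> > inverse (real (Suc k))})"
          using reals_Archimedean by blast
      qed
      ultimately have "measure \<mu> (- Z) \<le> 0"
        using finite_measure_mono[of "- Z" "\<Union>k. {q. \<bar>f q\<bar> > inverse (real (Suc k))}"]
        unfolding null_sets_def measure_def by simp
      then show False using \<open>measure \<mu> (- Z) > 0\<close> by simp
    qed
    then obtain k where k: "measure \<mu> {q. \<bar>f q\<bar> > inverse (real (Suc k))} > 0" ..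
    define \<epsilon> where "\<epsilon> = inverse (real (Suc k))"
    obtain \<delta> where \<delta>: "\<delta> > 0" "\<forall>\<^sub>F n in sequentially. \<delta> \<le> empirical_freq p n {q. \<bar>f q\<bar> > \<epsilon>}"
      using empirical_freq_open_bounded_below[OF \<mu>(1,2) conv open_U] k unfolding \<epsilon>_def by blast
    have "empirical_freq p n {q. \<bar>f q\<bar> > \<epsilon>} = empirical_freq (Phi p) n {w. \<bar>w \<bullet> v\<bar> > \<epsilon>}" for n
      by (simp only: empirical_freq_def indicator_def mem_Collect_eq Phi_inner f_def a_def)
    moreover have "\<epsilon> > 0" by (simp add: \<epsilon>_def)
    ultimately show ?thesis using \<delta> by auto
  qed
  show thesis
    by (rule uniform_quadratic_form_bound[OF B pos]) (use that in auto)
qed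

section \<open>Moments of the noise\<close>

text \<open>The Gaussian moment generating function: completing the square turns the tilted density
  into a multiple of the normal density with mean \<open>s\<^sup>2 * t\<close>.\<close>

lemma normal_distributed_exp:
  assumes X: "distributed M lborel X (normal_density 0 s)" and s: "s > 0"
  shows "integrable M (\<lambda>x. exp (t * X x))"
    and "(\<integral>x. exp (t * X x) \<partial>M) = exp (s\<^sup>2 * t\<^sup>2 / 2)"
proof -
  have eq: "normal_density 0 s u * exp (t * u) = exp (s\<^sup>2 * t\<^sup>2 / 2) * normal_density (s\<^sup>2 * t) s u" for u
  proof -
    have "- (u\<^sup>2 / (2 * s\<^sup>2)) + t * u = s\<^sup>2 * t\<^sup>2 / 2 - (u - s\<^sup>2 * t)\<^sup>2 / (2 * s\<^sup>2)"
      using s by (simp add: field_simps power2_eq_square)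
    then show ?thesis
      by (simp add: normal_density_def mult_exp_exp)
  qed
  have "integrable lborel (\<lambda>u. normal_density 0 s u * exp (t * u))"
    unfolding eq using s by simp
  then show "integrable M (\<lambda>x. exp (t * X x))"
    using distributed_integrable[OF X, of "\<lambda>u. exp (t * u)"] by simp
  have "(\<integral>u. normal_density 0 s u * exp (t * u) \<partial>lborel) = exp (s\<^sup>2 * t\<^sup>2 / 2)"
    unfolding eq using s by simp
  then show "(\<integral>x. exp (t * X x) \<partial>M) = exp (s\<^sup>2 * t\<^sup>2 / 2)"
    using distributed_integral[OF X, of "\<lambda>u. exp (t * u)"] by simp
qed

text \<open>Expanding the squared norm gives a double sum whose off-diagonal terms vanish by
  independence and centering.\<close>

lemma (in prob_space) second_moment_sum_centered:
  fixes w :: "'i \<Rightarrow> 'b::euclidean_space" and Z :: "'i \<Rightarrow> 'a \<Rightarrow> real"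
  assumes "finite I" and indep: "indep_vars (\<lambda>_. borel) Z I"
    and int: "\<And>i. i \<in> I \<Longrightarrow> integrable M (Z i)"
    and int2: "\<And>i. i \<in> I \<Longrightarrow> integrable M (\<lambda>x. (Z i x)\<^sup>2)"
    and mean: "\<And>i. i \<in> I \<Longrightarrow> expectation (Z i) = 0"
  shows "integrable M (\<lambda>x. (norm (\<Sum>i\<in>I. Z i x *\<^sub>R w i))\<^sup>2)"
    and "expectation (\<lambda>x. (norm (\<Sum>i\<in>I. Z i x *\<^sub>R w i))\<^sup>2)
      = (\<Sum>i\<in>I. expectation (\<lambda>x. (Z i x)\<^sup>2) * (norm (w i))\<^sup>2)"
proof -
  have eq: "(norm (\<Sum>i\<in>I. Z i x *\<^sub>R w i))\<^sup>2 = (\<Sum>i\<in>I. \<Sum>j\<in>I. Z i x * Z j x * (w i \<bullet> w j))" for x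
    by (simp add: power2_norm_eq_inner inner_sum_left inner_sum_right sum_distrib_left mult_ac)
      (simp add: inner_commute)
  have cross: "integrable M (\<lambda>x. Z i x * Z j x)"
      "expectation (\<lambda>x. Z i x * Z j x) = (if i = j then expectation (\<lambda>x. (Z i x)\<^sup>2) else 0)"
    if "i \<in> I" "j \<in> I" for i j
  proof -
    have *: "indep_vars (\<lambda>_. borel) Z {i, j}"
      using indep that by (intro indep_vars_subset[OF indep]) auto
    note ** = indep_vars_integrable[OF _ *] indep_vars_lebesgue_integral[OF _ *]
    show "integrable M (\<lambda>x. Z i x * Z j x)"
      using **(1) int int2 that by (cases "i = j") (auto simp: power2_eq_square)
    show "expectation (\<lambda>x. Z i x * Z j x) = (if i = j then expectation (\<lambda>x. (Z i x)\<^sup>2) else 0)"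
      using **(2) int mean that by (cases "i = j") (auto simp: power2_eq_square)
  qed
  show "integrable M (\<lambda>x. (norm (\<Sum>i\<in>I. Z i x *\<^sub>R w i))\<^sup>2)"
    unfolding eq by (intro Bochner_Integration.integrable_sum integrable_mult_left cross)
  have "expectation (\<lambda>x. (norm (\<Sum>i\<in>I. Z i x *\<^sub>R w i))\<^sup>2) =
    (\<Sum>i\<in>I. \<Sum>j\<in>I. expectation (\<lambda>x. Z i x * Z j x) * (w i \<bullet> w j))"
    unfolding eq using cross(1)
    by (subst Bochner_Integration.integral_sum, force, intro sum.cong refl,
        subst Bochner_Integration.integral_sum) auto
  also have "\<dots> = (\<Sum>i\<in>I. expectation (\<lambda>x. (Z i x)\<^sup>2) * (norm (w i))\<^sup>2)"
    using assms(1) cross(2)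
    by (intro sum.cong refl) (simp add: if_distrib[of "\<lambda>c. c * _"] sum.delta power2_norm_eq_inner cong: if_cong sum.cong)
  finally show "expectation (\<lambda>x. (norm (\<Sum>i\<in>I. Z i x *\<^sub>R w i))\<^sup>2)
      = (\<Sum>i\<in>I. expectation (\<lambda>x. (Z i x)\<^sup>2) * (norm (w i))\<^sup>2)" .
qed

section \<open>Error propagation\<close>

lemma transpose_mult_self_mult:
  "transpose_mult_self n A *v v = (\<Sum>i=1..n. (A i \<bullet> v) *\<^sub>R A i)"
  by (simp add: vec_eq_iff transpose_mult_self_def matrix_vector_mult_def inner_vec_def
      sum_distrib_right sum_distrib_left mult_ac) (subst sum.swap, simp add: mult_ac)

lemma transpose_mult_vec_eq: "transpose_mult_vec n A g = (\<Sum>i=1..n. g i *\<^sub>R A i)"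
  by (simp add: vec_eq_iff transpose_mult_vec_def mult.commute)

text \<open>The error solves the normal equations with right-hand side the sum of the
  \<open>e i *\<^sub>R A i\<close>. Pairing them with the error itself, the lower bound and
  Cauchy-Schwarz leave one factor of its norm to cancel.\<close>

lemma least_squares_error:
  fixes A :: "nat \<Rightarrow> real ^ 'k"
  assumes c: "c > 0"
    and lower: "\<And>v. c * (norm v)\<^sup>2 \<le> (\<Sum>i=1..n. (A i \<bullet> v)\<^sup>2)"
    and g: "\<And>i. i \<in> {1..n} \<Longrightarrow> g i = A i \<bullet> \<beta> + e i"
  shows "c * norm (matrix_inv (transpose_mult_self n A) *v transpose_mult_vec n A g - \<beta>)
    \<le> norm (\<Sum>i=1..n. e i *\<^sub>R A i)"
proof -
  let ?G = "transpose_mult_self n A"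
  define d where "d = matrix_inv ?G *v transpose_mult_vec n A g - \<beta>"
  have quad: "v \<bullet> (?G *v v) = (\<Sum>i=1..n. (A i \<bullet> v)\<^sup>2)" for v
    by (simp add: transpose_mult_self_mult inner_sum_right power2_eq_square inner_commute)
  \<comment> \<open>A trivial kernel makes the Gram matrix invertible, so that
    \<open>matrix_inv\<close>, defined by choice, is a genuine inverse.\<close>
  have "v = 0" if "?G *v v = 0" for v
  proof -
    have "c * (norm v)\<^sup>2 \<le> 0"
      using lower[of v] quad[of v] that by simp
    then show ?thesis using c by (simp add: mult_le_0_iff)
  qed
  then have "invertible ?G"
    by (simp add: invertible_left_inverse matrix_left_invertible_ker)
  then have "?G ** matrix_inv ?G = mat 1"
    unfolding invertible_def matrix_inv_def by (metis (mono_tags, lifting) someI_ex)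
  then have "?G *v (matrix_inv ?G *v w) = w" for w
    by (simp add: matrix_vector_mul_assoc)
  then have "?G *v d = transpose_mult_vec n A g - ?G *v \<beta>"
    by (simp add: d_def matrix_vector_mult_diff_distrib)
  also have "\<dots> = (\<Sum>i=1..n. e i *\<^sub>R A i)"
    by (simp add: transpose_mult_vec_eq transpose_mult_self_mult g scaleR_add_left
        flip: sum_subtractf)
  finally have "c * (norm d)\<^sup>2 \<le> d \<bullet> (\<Sum>i=1..n. e i *\<^sub>R A i)"
    using lower[of d] quad[of d] by simp
  also have "\<dots> \<le> norm d * norm (\<Sum>i=1..n. e i *\<^sub>R A i)"
    by (rule norm_cauchy_schwarz)
  finally have "norm d * (c * norm d) \<le> norm d * norm (\<Sum>i=1..n. e i *\<^sub>R A i)"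
    by (simp add: power2_eq_square mult_ac)
  then have "c * norm d \<le> norm (\<Sum>i=1..n. e i *\<^sub>R A i)"
    by (cases "d = 0") auto
  then show ?thesis by (simp add: d_def)
qed

text \<open>The coefficients of \<open>\<gamma> * (norm (q - p0))\<^sup>2\<close> as a polynomial in
  \<open>q\<close>, in the basis given by the columns of \<open>Phi\<close>. Dividing by the last
  entry cancels \<gamma> and recovers \<open>p0\<close>.\<close>

definition beta_true :: "real \<Rightarrow> real ^ 'm \<Rightarrow> real ^ ('m + 2)" where
  "beta_true \<gamma> p0 = (\<chi> j. \<gamma> * (case j of Inl k \<Rightarrow> p0 $ k | Inr l \<Rightarrow> if l = 1 then (norm p0)\<^sup>2 else 1))"

lemma Phi_inner_beta_true:
  "Phi p i \<bullet> beta_true \<gamma> p0 = \<gamma> * (norm (p i - p0))\<^sup>2"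
proof -
  have "(\<chi> k. beta_true \<gamma> p0 $ Inl k) = \<gamma> *\<^sub>R p0"
    by (simp add: vec_eq_iff beta_true_def)
  then show ?thesis
    unfolding Phi_inner
    by (simp add: beta_true_def power2_norm_eq_inner inner_diff inner_commute algebra_simps)
qed

text \<open>An error of at most \<open>\<gamma> / 2\<close> keeps the denominator at least
  \<open>\<gamma> / 2\<close>; after \<open>p0\<close> is subtracted, the numerator is linear in the
  error.\<close>

lemma ratio_error:
  fixes p0 :: "real ^ 'm" and \<beta> :: "real ^ ('m + 2)"
  assumes \<gamma>: "\<gamma> > 0" and close: "norm (\<beta> - beta_true \<gamma> p0) \<le> \<gamma> / 2"
  shows "norm ((\<chi> k. \<beta> $ Inl k / \<beta> $ Inr 2) - p0)
    \<le> 2 / \<gamma> * (real CARD('m) + norm p0) * norm (\<beta> - beta_true \<gamma> p0)"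
proof -
  define d where "d = \<beta> - beta_true \<gamma> p0"
  have comp: "\<bar>d $ j\<bar> \<le> norm d" for j by (rule component_le_norm_cart)
  have l: "\<beta> $ Inl k = \<gamma> * p0 $ k + d $ Inl k" for k
    by (simp add: d_def beta_true_def)
  have r: "\<beta> $ Inr 2 = \<gamma> + d $ Inr 2"
    by (simp add: d_def beta_true_def)
  have den: "\<beta> $ Inr 2 \<ge> \<gamma> / 2"
    using comp[of "Inr 2"] close unfolding r d_def[symmetric] by linarith
  have "(\<chi> k. \<beta> $ Inl k / \<beta> $ Inr 2) - p0 =
      (1 / \<beta> $ Inr 2) *\<^sub>R ((\<chi> k. d $ Inl k) - d $ Inr 2 *\<^sub>R p0)"
  proof -
    have "\<beta> $ Inl k / \<beta> $ Inr 2 - p0 $ k = (d $ Inl k - d $ Inr 2 * p0 $ k) / \<beta> $ Inr 2" for k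
      using den \<gamma> unfolding l r by (simp add: field_simps)
    then show ?thesis by (simp add: vec_eq_iff)
  qed
  then have "norm ((\<chi> k. \<beta> $ Inl k / \<beta> $ Inr 2) - p0) =
      (1 / \<beta> $ Inr 2) * norm ((\<chi> k. d $ Inl k) - d $ Inr 2 *\<^sub>R p0)"
    using den \<gamma> by simp
  also have "\<dots> \<le> (2 / \<gamma>) * ((real CARD('m) + norm p0) * norm d)"
  proof (intro mult_mono)
    show "1 / \<beta> $ Inr 2 \<le> 2 / \<gamma>"
      using den \<gamma> by (simp add: field_simps)
    have "norm (\<chi> k. d $ Inl k) \<le> (\<Sum>k\<in>(UNIV :: 'm set). \<bar>d $ Inl k\<bar>)"
      using norm_le_l1_cart[of "\<chi> k. d $ Inl k"] by simp
    also have "\<dots> \<le> real CARD('m) * norm d"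
      using sum_bounded_above[of UNIV "\<lambda>k. \<bar>d $ Inl k\<bar>" "norm d"] comp by simp
    finally have "norm (\<chi> k. d $ Inl k) \<le> real CARD('m) * norm d" .
    moreover have "norm (d $ Inr 2 *\<^sub>R p0) \<le> norm d * norm p0"
      using comp by (simp add: mult_right_mono)
    ultimately show "norm ((\<chi> k. d $ Inl k) - d $ Inr 2 *\<^sub>R p0) \<le> (real CARD('m) + norm p0) * norm d"
      using norm_triangle_ineq4[of "\<chi> k. d $ Inl k" "d $ Inr 2 *\<^sub>R p0"] by (simp add: algebra_simps)
  qed (use \<gamma> in auto)
  finally show ?thesis by (simp only: d_def mult.assoc)
qed

text \<open>The positions are deterministic, so the inverse Gram matrix is constant and each entry
  of \<open>beta_hat\<close> is a fixed linear combination of the entries of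
  \<open>Gam\<close>.\<close>

lemma borel_measurable_p_hat:
  fixes p :: "nat \<Rightarrow> real ^ 'm"
  assumes [measurable]: "\<And>i. i \<in> {1..n} \<Longrightarrow> y i \<in> borel_measurable M"
  shows "(\<lambda>x. p_hat p (\<lambda>i. y i x) n) \<in> borel_measurable M"
proof -
  have [measurable]: "(\<lambda>x. beta_hat p (\<lambda>i. y i x) n $ j) \<in> borel_measurable M" for j
    unfolding beta_hat_def matrix_vector_mult_def transpose_mult_vec_def Gam_def
    by simp
  show ?thesis
    by (subst borel_measurable_euclidean_space)
      (auto simp: Basis_vec_def inner_axis p_hat_def)
qed

theorem theorem3:
  fixes M :: "'a measure"
    and p0 :: "real ^ 'm" and p :: "nat \<Rightarrow> real ^ 'm"
    and P0 P :: "(real ^ 'm) set" and \<mu> :: "(real ^ 'm) measure"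
    and \<alpha> \<sigma> :: real and \<omega> y :: "nat \<Rightarrow> 'a \<Rightarrow> real"
  assumes dim: "CARD('m) \<in> {2, 3}"
    and prob: "prob_space M"
    and alpha: "\<alpha> > 0"
    and sigma: "\<sigma>\<^sup>2 > 0"
    and noise_indep: "prob_space.indep_vars M (\<lambda>_. borel) \<omega> {1..}"
    and noise_normal: "\<And>i. i \<ge> 1 \<Longrightarrow>
      distributed M lborel (\<omega> i) (normal_density 0 (sqrt (\<sigma>\<^sup>2 / (100 * \<alpha>\<^sup>2))))"
    and model: "\<And>i x. i \<ge> 1 \<Longrightarrow> x \<in> space M \<Longrightarrow>
      y i x = log 10 (norm (p i - p0)) + \<omega> i x"
    and a_source: "bounded P0" "p0 \<in> P0"
    and a_sensors: "bounded P" "\<And>i. i \<ge> 1 \<Longrightarrow> p i \<in> P"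
    and a_disjoint: "P0 \<inter> P = {}"
    and b_mu: "prob_space \<mu>" "sets \<mu> = sets borel" "AE q in \<mu>. q \<in> P"
    and b_conv: "mv_weak_conv (empirical_cdf p) (mv_cdf \<mu>)"
    and c_finite: "\<And>n. n \<ge> CARD('m) + 1 \<Longrightarrow> \<not> on_line_or_plane (p ` {1..n})"
    and c_limit: "\<not> (\<exists>P'. P' \<subseteq> P \<and> measure \<mu> P' = 1 \<and> on_line_or_plane P')"
    and d_finite: "\<And>n. n \<ge> CARD('m) + 2 \<Longrightarrow> \<not> on_circle_or_sphere (p ` {1..n})"
    and d_limit: "\<not> (\<exists>P'. P' \<subseteq> P \<and> measure \<mu> P' = 1 \<and> on_circle_or_sphere P')"
  shows "O_prob M (\<lambda>n x. p_hat p (\<lambda>i. y i x) n - p0) (\<lambda>n. 1 / sqrt (real n))"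
proof -
  interpret prob_space M by fact

  \<comment> \<open>Moments of the centered multiplicative noise\<close>
  define s where "s = sqrt (\<sigma>\<^sup>2 / (100 * \<alpha>\<^sup>2))"
  have s: "s > 0" using alpha sigma by (simp add: s_def)
  \<comment> \<open>Chosen so that \<open>10 powr (2 * \<omega> i x)\<close> is
    \<open>exp (t * \<omega> i x)\<close>; \<gamma> is then its mean and \<open>V\<close> its
    variance.\<close>
  define t where "t = 2 * ln (10 :: real)"
  define \<gamma> where "\<gamma> = exp (s\<^sup>2 * t\<^sup>2 / 2)"
  have \<gamma>: "\<gamma> > 0" by (simp add: \<gamma>_def)
  define Z where "Z i x = exp (t * \<omega> i x) - \<gamma>" for i x
  define V where "V = exp (s\<^sup>2 * (2 * t)\<^sup>2 / 2) - \<gamma>\<^sup>2"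
  have \<omega>_meas: "\<omega> i \<in> borel_measurable M" if "i \<ge> 1" for i
    using noise_indep that by (simp add: indep_vars_def)
  have Z: "integrable M (Z i)" "expectation (Z i) = 0" "integrable M (\<lambda>x. (Z i x)\<^sup>2)"
      "expectation (\<lambda>x. (Z i x)\<^sup>2) = V" if "i \<ge> 1" for i
  proof -
    note ex = normal_distributed_exp[OF noise_normal[OF that, folded s_def] s]
    note [simp] = ex(1)[of t] ex(1)[of "2 * t"] ex(2)[of t, folded \<gamma>_def] ex(2)[of "2 * t"]
    have sq: "(Z i x)\<^sup>2 = exp (2 * t * \<omega> i x) - 2 * \<gamma> * exp (t * \<omega> i x) + \<gamma>\<^sup>2" for x
      by (simp add: Z_def power2_diff exp_double[symmetric] mult_ac)
    show "integrable M (Z i)" "expectation (Z i) = 0"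
      unfolding Z_def by (simp_all add: prob_space)
    show "integrable M (\<lambda>x. (Z i x)\<^sup>2)" "expectation (\<lambda>x. (Z i x)\<^sup>2) = V"
      unfolding sq by (simp_all add: prob_space V_def power2_eq_square)
  qed
  have V: "V \<ge> 0"
    using Z(4)[of 1] Bochner_Integration.integral_nonneg[of M "\<lambda>x. (Z 1 x)\<^sup>2"] by simp
  have Z_indep: "indep_vars (\<lambda>_. borel) Z {1..n}" for n
    unfolding Z_def
    by (rule indep_vars_compose2[OF indep_vars_subset[OF noise_indep]]) auto

  \<comment> \<open>The observations as a linear regression\<close>
  define r where "r i = norm (p i - p0)" for i
  \<comment> \<open>Disjointness of \<open>P0\<close> and \<open>P\<close> keeps sensors off the
    source, so that \<open>10 powr log 10 (r i)\<close> recovers \<open>r i\<close>.\<close>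
  have r: "r i > 0" if "i \<ge> 1" for i
    using a_sensors(2)[OF that] a_source(2) a_disjoint by (auto simp: r_def)
  have Gam: "Gam (\<lambda>i. y i x) i = Phi p i \<bullet> beta_true \<gamma> p0 + (r i)\<^sup>2 * Z i x"
    if "i \<ge> 1" "x \<in> space M" for i x
  proof -
    have "Gam (\<lambda>i. y i x) i = (10 powr log 10 (r i))\<^sup>2 * exp (t * \<omega> i x)"
      using model[OF that]
      by (simp add: Gam_def r_def t_def powr_def exp_double[symmetric] exp_add[symmetric]
          distrib_left distrib_right mult_ac)
    also have "10 powr log 10 (r i) = r i"
      using r[OF that(1)] by simp
    finally show ?thesis
      by (simp add: Phi_inner_beta_true Z_def r_def algebra_simps)
  qed

  \<comment> \<open>Second moment and tail of the noise term\<close>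
  obtain B where B: "B > 0" "\<And>i. i \<ge> 1 \<Longrightarrow> norm (Phi p i) \<le> B"
    using bounded_Phi[of P p] a_sensors by blast
  obtain R0 where R0: "R0 > 0" "\<And>q. q \<in> P \<Longrightarrow> norm q \<le> R0"
    using a_sensors(1) by (meson bounded_pos)
  define R where "R = R0 + norm p0"
  have R: "r i \<le> R" if "i \<ge> 1" for i
    using R0(2)[OF a_sensors(2)[OF that]] norm_triangle_ineq4[of "p i" p0] by (simp add: r_def R_def)
  \<comment> \<open>The noise in row \<open>i\<close> is scaled by the squared distance. Moving this
    factor into the row makes \<open>T\<close> a sum of independent centered scalars times fixed
    bounded vectors.\<close>
  define w where "w i = (r i)\<^sup>2 *\<^sub>R Phi p i" for i
  define T where "T n x = (\<Sum>i=1..n. Z i x *\<^sub>R w i)" for n x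
  define D where "D = V * (R\<^sup>2 * B)\<^sup>2"
  have D: "D \<ge> 0" using V by (simp add: D_def)
  have T_int: "integrable M (\<lambda>x. (norm (T n x))\<^sup>2)" for n
    unfolding T_def using Z by (intro second_moment_sum_centered Z_indep) auto
  have T_moment: "expectation (\<lambda>x. (norm (T n x))\<^sup>2) \<le> real n * D" for n
  proof -
    have "expectation (\<lambda>x. (norm (T n x))\<^sup>2) = (\<Sum>i=1..n. expectation (\<lambda>x. (Z i x)\<^sup>2) * (norm (w i))\<^sup>2)"
      unfolding T_def using Z by (intro second_moment_sum_centered Z_indep) auto
    also have "\<dots> \<le> (\<Sum>i=1..n. D)"
    proof (rule sum_mono)
      fix i assume "i \<in> {1..n}"
      then have i: "i \<ge> 1" by simp
      have "norm (w i) \<le> R\<^sup>2 * B"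
        using B(2)[OF i] R[OF i] r[OF i] by (auto simp: w_def intro!: mult_mono power_mono)
      then show "expectation (\<lambda>x. (Z i x)\<^sup>2) * (norm (w i))\<^sup>2 \<le> D"
        using V by (auto simp: Z(4)[OF i] D_def intro!: mult_left_mono power_mono)
    qed
    finally show ?thesis by simp
  qed
  \<comment> \<open>Chebyshev's inequality: Markov applied to the squared norm, where the factor
    \<open>n\<close> cancels.\<close>
  have T_tail: "measure M {x \<in> space M. norm (T n x) > L * sqrt (real n)} \<le> D / L\<^sup>2"
    if "n \<ge> 1" "L > 0" for n L
  proof -
    have L: "L\<^sup>2 * real n > 0" using that by simp
    have sub: "{x \<in> space M. norm (T n x) > L * sqrt (real n)} \<subseteq>
        {x \<in> space M. (norm (T n x))\<^sup>2 \<ge> L\<^sup>2 * real n}"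
    proof clarify
      fix x assume "norm (T n x) > L * sqrt (real n)"
      then have "(L * sqrt (real n))\<^sup>2 \<le> (norm (T n x))\<^sup>2"
        using that by (intro power_mono) auto
      then show "(norm (T n x))\<^sup>2 \<ge> L\<^sup>2 * real n"
        by (simp add: power_mult_distrib)
    qed
    have [measurable]: "(\<lambda>x. (norm (T n x))\<^sup>2) \<in> borel_measurable M"
      using T_int by (rule borel_measurable_integrable)
    have "measure M {x \<in> space M. norm (T n x) > L * sqrt (real n)} \<le>
        measure M {x \<in> space M. (norm (T n x))\<^sup>2 \<ge> L\<^sup>2 * real n}"
      by (rule finite_measure_mono[OF sub]) measurable
    also have "\<dots> \<le> expectation (\<lambda>x. (norm (T n x))\<^sup>2) / (L\<^sup>2 * real n)"
      by (rule integral_Markov_inequality_measure[where A = "{}", OF T_int _ _ L]) auto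
    also have "\<dots> \<le> real n * D / (L\<^sup>2 * real n)"
      using T_moment L by (intro divide_right_mono) auto
    also have "\<dots> = D / L\<^sup>2" using that by simp
    finally show ?thesis .
  qed

  \<comment> \<open>Boundedness in probability of the rescaled error\<close>
  obtain c where c: "c > 0"
    "\<forall>\<^sub>F n in sequentially. \<forall>v. c * real n * (norm v)\<^sup>2 \<le> (\<Sum>i=1..n. (Phi p i \<bullet> v)\<^sup>2)"
    using Phi_quadratic_form_lower_bound[OF dim a_sensors b_mu b_conv c_limit d_limit] by blast
  define C where "C = 2 / \<gamma> * (real CARD('m) + norm p0)"
  have "\<exists>K N. \<forall>n\<ge>N. measure M {x \<in> space M.
      norm ((p_hat p (\<lambda>i. y i x) n - p0) /\<^sub>R (1 / sqrt (real n))) > K} < \<epsilon>" if "\<epsilon> > 0" for \<epsilon>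
  proof -
    \<comment> \<open>Makes \<open>D / L\<^sup>2\<close> equal to
      \<open>D * \<epsilon> / (D + 1)\<close>, below \<epsilon>; the added 1 keeps \<open>L\<close>
      positive even if \<open>D\<close> is 0.\<close>
    define L where "L = sqrt ((D + 1) / \<epsilon>)"
    have L: "L > 0" using D that by (simp add: L_def)
    have "D / L\<^sup>2 = D * \<epsilon> / (D + 1)" using D that by (simp add: L_def)
    also have "\<dots> < \<epsilon>" using D that by (simp add: field_simps)
    finally have D_L: "D / L\<^sup>2 < \<epsilon>" .
    define K where "K = C * (L / c)"
    have "\<forall>\<^sub>F n in sequentially. measure M {x \<in> space M.
        norm ((p_hat p (\<lambda>i. y i x) n - p0) /\<^sub>R (1 / sqrt (real n))) > K} < \<epsilon>"
      \<comment> \<open>The first threshold forces the coefficient error below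
        \<open>\<gamma> / 2\<close>, as \<open>ratio_error\<close> requires; the second makes
        \<open>sqrt (real n)\<close> positive.\<close>
      using c(2) eventually_ge_at_top[of "nat \<lceil>(2 * L / (c * \<gamma>))\<^sup>2\<rceil>"] eventually_ge_at_top[of 1]
    proof eventually_elim
      case (elim n)
      have n: "sqrt (real n) > 0" "real n = sqrt (real n) * sqrt (real n)" using elim(3) by auto
      have "(2 * L / (c * \<gamma>))\<^sup>2 \<le> real n" using elim(2) by linarith
      then have large: "2 * L / (c * \<gamma>) \<le> sqrt (real n)" by (rule real_le_rsqrt)
      \<comment> \<open>A deterministic bound off the tail event of \<open>T\<close>: dividing a
        noise term of order \<open>sqrt (real n)\<close> by the eigenvalue bound
        \<open>c * real n\<close> leaves an error of order \<open>1 / sqrt (real n)\<close>.\<close>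
      have "norm ((p_hat p (\<lambda>i. y i x) n - p0) /\<^sub>R (1 / sqrt (real n))) \<le> K"
        if x: "x \<in> space M" and T: "norm (T n x) \<le> L * sqrt (real n)" for x
      proof -
        define d where "d = beta_hat p (\<lambda>i. y i x) n - beta_true \<gamma> p0"
        have "c * real n * norm d \<le> norm (\<Sum>i=1..n. ((r i)\<^sup>2 * Z i x) *\<^sub>R Phi p i)"
          unfolding d_def beta_hat_def
          using elim(1,3) c(1) Gam x by (intro least_squares_error) auto
        also have "\<dots> = norm (T n x)"
          by (simp add: T_def w_def mult.commute)
        finally have "c * real n * norm d \<le> L * sqrt (real n)"
          using T by linarith
        then have "sqrt (real n) * (c * (sqrt (real n) * norm d)) \<le> sqrt (real n) * L"
          by (subst (asm) n(2)) (simp add: mult_ac)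
        then have "c * (sqrt (real n) * norm d) \<le> L"
          using n(1) by simp
        then have d: "sqrt (real n) * norm d \<le> L / c"
          using c(1) by (simp add: pos_le_divide_eq mult.commute)
        have "2 * L / (c * \<gamma>) * norm d \<le> L / c"
          using d mult_right_mono[OF large, of "norm d"] by simp
        then have "norm d \<le> \<gamma> / 2"
          using c(1) L \<gamma> by (simp add: field_simps)
        then have "norm (p_hat p (\<lambda>i. y i x) n - p0) \<le> C * norm d"
          unfolding p_hat_def d_def C_def by (rule ratio_error[OF \<gamma>])
        then have "sqrt (real n) * norm (p_hat p (\<lambda>i. y i x) n - p0) \<le> C * (sqrt (real n) * norm d)"
          using mult_left_mono[of _ _ "sqrt (real n)"] n(1) by (simp add: mult_ac)
        also have "\<dots> \<le> K"
          unfolding K_def using d \<gamma> by (intro mult_left_mono) (simp_all add: C_def)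
        finally show ?thesis by simp
      qed
      then have sub: "{x \<in> space M. norm ((p_hat p (\<lambda>i. y i x) n - p0) /\<^sub>R (1 / sqrt (real n))) > K}
          \<subseteq> {x \<in> space M. norm (T n x) > L * sqrt (real n)}"
        by (auto simp: not_le[symmetric])
      have "{x \<in> space M. norm (T n x) > L * sqrt (real n)} \<in> sets M"
      proof -
        have [measurable]: "T n \<in> borel_measurable M"
          unfolding T_def using Z(1)
          by (intro borel_measurable_sum borel_measurable_scaleR borel_measurable_const
              borel_measurable_integrable) auto
        show ?thesis by measurable
      qed
      then have "measure M {x \<in> space M. norm ((p_hat p (\<lambda>i. y i x) n - p0) /\<^sub>R (1 / sqrt (real n))) > K}
          \<le> measure M {x \<in> space M. norm (T n x) > L * sqrt (real n)}"
        by (rule finite_measure_mono[OF sub])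
      also have "\<dots> < \<epsilon>" using T_tail[OF elim(3) L] D_L by linarith
      finally show ?case .
    qed
    then show ?thesis unfolding eventually_sequentially by blast
  qed

  \<comment> \<open>Measurability of the estimation error\<close>
  moreover have "(\<lambda>x. p_hat p (\<lambda>i. y i x) n - p0) \<in> borel_measurable M" for n
  proof (intro borel_measurable_diff borel_measurable_p_hat borel_measurable_const)
    fix i assume "i \<in> {1..n}"
    then have i: "i \<ge> 1" by simp
    show "y i \<in> borel_measurable M"
      \<comment> \<open>The model equation is available only on \<open>space M\<close>, so
        measurability is transferred by congruence there.\<close>
      by (subst measurable_cong[where g = "\<lambda>x. log 10 (norm (p i - p0)) + \<omega> i x"])
        (use model \<omega>_meas i in auto)
  qed
  ultimately show ?thesis unfolding O_prob_def by blast
qed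

end
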